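(* For every integer $n\geq 3$, the triangular fan graph $TF_n$ has an interval $\Delta(TF_n)$-coloring.
   Context: All graphs are finite, undirected, without loops or multiple edges. $\Delta(G)$ is the maximum degree of $G$. For a proper edge-coloring $\alpha$ of $G$ (adjacent edges receive different colors) and a vertex $v$, $S(v,\alpha)$ denotes the set of colors of edges incident to $v$. A proper edge-coloring $\alpha$ of $G$ with colors $1,\ldots,t$ is an interval $t$-coloring if all colors $1,\ldots,t$ are used and, for every vertex $v$ of $G$, $S(v,\alpha)$ is an interval of integers (a set of consecutive integers). For $n\geq 3$, the triangular fan graph $TF_n$ is the graph with pairwise distinct vertices $V(TF_n)=\{u,v_1,\ldots,v_{n-1},w_1,\ldots,w_{n-2}\}$ and edge set $E(TF_n)=\{uv_i : 1\leq i\leq n-1\}\cup\{v_iw_i,\ w_iv_{i+1},\ v_iv_{i+1} : 1\leq i\leq n-2\}$. *)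

theory Defs
  imports Main
begin

text \<open>Graphs are pairs of a vertex set and an edge set, edges being two-element sets of vertices.\<close>

type_synonym 'a ugraph = "'a set \<times> 'a set set"

abbreviation verts :: "'a ugraph \<Rightarrow> 'a set" where "verts G \<equiv> fst G"
abbreviation edges :: "'a ugraph \<Rightarrow> 'a set set" where "edges G \<equiv> snd G"

definition simple_graph :: "'a ugraph \<Rightarrow> bool" where
  "simple_graph G \<longleftrightarrow> finite (verts G) \<and> (\<forall>e\<in>edges G. e \<subseteq> verts G \<and> card e = 2)"

definition incident_edges :: "'a ugraph \<Rightarrow> 'a \<Rightarrow> 'a set set" where
  "incident_edges G x = {e \<in> edges G. x \<in> e}"

definition degree :: "'a ugraph \<Rightarrow> 'a \<Rightarrow> nat" where
  "degree G x = card (incident_edges G x)"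

text \<open>Only meaningful for a finite nonempty vertex set.\<close>

definition max_degree :: "'a ugraph \<Rightarrow> nat" where
  "max_degree G = Max (degree G ` verts G)"

definition proper_edge_coloring :: "'a ugraph \<Rightarrow> ('a set \<Rightarrow> nat) \<Rightarrow> bool" where
  "proper_edge_coloring G \<alpha> \<longleftrightarrow>
     (\<forall>e\<in>edges G. \<forall>f\<in>edges G. e \<noteq> f \<and> e \<inter> f \<noteq> {} \<longrightarrow> \<alpha> e \<noteq> \<alpha> f)"

definition spectrum :: "'a ugraph \<Rightarrow> ('a set \<Rightarrow> nat) \<Rightarrow> 'a \<Rightarrow> nat set" where
  "spectrum G \<alpha> x = \<alpha> ` incident_edges G x"

text \<open>The image condition says both that every color lies in \<open>{1..t}\<close> and that every such color
  is used. The empty spectrum of an isolated vertex counts as an interval (\<open>a > b\<close>).\<close>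

definition interval_coloring :: "'a ugraph \<Rightarrow> nat \<Rightarrow> ('a set \<Rightarrow> nat) \<Rightarrow> bool" where
  "interval_coloring G t \<alpha> \<longleftrightarrow>
     proper_edge_coloring G \<alpha> \<and>
     \<alpha> ` edges G = {1..t} \<and>
     (\<forall>x\<in>verts G. \<exists>a b. spectrum G \<alpha> x = {a..b})"

text \<open>The datatype makes the vertices \<open>u\<close>, \<open>v\<^sub>i\<close>, \<open>w\<^sub>i\<close> pairwise distinct.\<close>

datatype tf_vertex = U | V nat | W nat

definition triangular_fan :: "nat \<Rightarrow> tf_vertex ugraph" where
  "triangular_fan n =
     ({U} \<union> V ` {1..n - 1} \<union> W ` {1..n - 2},
      {{U, V i} | i. i \<in> {1..n - 1}} \<union>
      (\<Union>i\<in>{1..n - 2}. {{V i, W i}, {W i, V (i + 1)}, {V i, V (i + 1)}}))"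

lemma simple_graph_triangular_fan: "simple_graph (triangular_fan n)"
  by (auto simp: simple_graph_def triangular_fan_def)

end

theory Submission
  imports Defs
begin

text \<open>
  Write \<open>m = n - 1\<close> and call \<open>{v\<^sub>i, w\<^sub>i, v\<^sub>i\<^sub>+\<^sub>1}\<close> the \<open>i\<close>-th triangle. A coloring is given by four sequences:
  \<open>c i\<close> for the spoke \<open>u v\<^sub>i\<close> and \<open>p i\<close>, \<open>a i\<close>, \<open>b i\<close> for the edges \<open>v\<^sub>i v\<^sub>i\<^sub>+\<^sub>1\<close>, \<open>v\<^sub>i w\<^sub>i\<close>, \<open>w\<^sub>i v\<^sub>i\<^sub>+\<^sub>1\<close> of the
  \<open>i\<close>-th triangle.

  The idea is a pattern that moves up by one color per triangle: with \<open>c i = i\<close>, \<open>p i = i - 2\<close>,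
  \<open>a i = i + 1\<close>, \<open>b i = i\<close>, the five edges at \<open>v\<^sub>i\<close> have the colors
  \<open>c i = i\<close>, \<open>p (i - 1) = i - 3\<close>, \<open>b (i - 1) = i - 1\<close>, \<open>p i = i - 2\<close>, \<open>a i = i + 1\<close>, which fill the window
  from \<open>i - 3\<close> to \<open>i + 1\<close>; at \<open>w\<^sub>i\<close> the colors are \<open>i\<close> and \<open>i + 1\<close>, and the spokes use \<open>1, \<dots>, m\<close> once
  each. The pattern only fails near the two ends of the path. At the beginning the window would
  leave the positive integers, and at the end \<open>v\<^sub>m\<close> would get the colors \<open>m - 3, m - 1, m\<close>. Both are
  repaired by changing the first two triangles and the last one and by exchanging the spoke colors
  \<open>1, 2\<close> and \<open>m - 1, m\<close> (lemma \<open>interval_coloring_shifting\<close>). The two repairs do not interfere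
  when \<open>m \<ge> 4\<close>; the fans with \<open>m = 2\<close> and \<open>m = 3\<close> are colored individually.

  That such a coloring uses exactly the colors \<open>1, \<dots>, \<Delta>\<close> needs no formula for \<open>\<Delta>\<close>: if the colors at
  every vertex \<open>x\<close> are \<open>deg x\<close> consecutive numbers between \<open>1\<close> and \<open>\<Delta>\<close>, then a vertex of degree \<open>\<Delta>\<close>
  sees all of them (lemma \<open>interval_coloring_max_degreeI\<close>). So it is enough to stay below lower
  bounds for \<open>\<Delta>\<close>, which are the degrees \<open>m\<close> of \<open>u\<close>, \<open>5\<close> of an inner \<open>v\<^sub>i\<close>, and \<open>3\<close> of \<open>v\<^sub>1\<close>.
\<close>

section \<open>Interval colorings with as many colors as the maximum degree\<close>

lemma finite_incident_edges:
  assumes "simple_graph G"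
  shows "finite (incident_edges G x)"
proof -
  have "edges G \<subseteq> Pow (verts G)" "finite (verts G)"
    using assms by (auto simp: simple_graph_def)
  then have "finite (edges G)"
    by (meson finite_Pow_iff finite_subset)
  then show ?thesis by (simp add: incident_edges_def)
qed

lemma degree_le_max_degree:
  assumes "simple_graph G" "x \<in> verts G"
  shows "degree G x \<le> max_degree G"
  using assms by (simp add: simple_graph_def max_degree_def)

text \<open>As many colors as edges at a vertex forces these edges to have distinct colors, so the
  coloring is proper. A vertex of maximum degree \<open>\<Delta>\<close> sees \<open>\<Delta>\<close> colors among \<open>1, \<dots>, \<Delta>\<close>, hence every
  color occurs.\<close>

lemma interval_coloring_max_degreeI:
  assumes G: "simple_graph G" and ne: "verts G \<noteq> {}"
    and spec: "\<And>x. x \<in> verts G \<Longrightarrow> \<exists>s. spectrum G \<alpha> x = {s..<s + degree G x}"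
    and bound: "\<And>x. x \<in> verts G \<Longrightarrow> spectrum G \<alpha> x \<subseteq> {1..max_degree G}"
  shows "interval_coloring G (max_degree G) \<alpha>"
  unfolding interval_coloring_def
proof (intro conjI ballI)
  have in_verts: "x \<in> verts G" if "e \<in> edges G" "x \<in> e" for e x
    using G that by (auto simp: simple_graph_def)
  have inj: "inj_on \<alpha> (incident_edges G x)" if x: "x \<in> verts G" for x
  proof (rule eq_card_imp_inj_on)
    show "finite (incident_edges G x)" by (rule finite_incident_edges[OF G])
    show "card (\<alpha> ` incident_edges G x) = card (incident_edges G x)"
      using spec[OF x] by (auto simp: spectrum_def degree_def)
  qed
  show "proper_edge_coloring G \<alpha>"
    unfolding proper_edge_coloring_def
  proof (intro ballI impI)
    fix e f assume e: "e \<in> edges G" and f: "f \<in> edges G" and ef: "e \<noteq> f \<and> e \<inter> f \<noteq> {}"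
    then obtain x where x: "x \<in> e" "x \<in> f" by auto
    show "\<alpha> e \<noteq> \<alpha> f"
      using inj_onD[OF inj[OF in_verts[OF e x(1)]], of e f] e f ef x
      by (auto simp: incident_edges_def)
  qed
  have fin: "finite (verts G)" using G by (simp add: simple_graph_def)
  have "max_degree G \<in> degree G ` verts G"
    unfolding max_degree_def using fin ne by (intro Max_in) auto
  then obtain x where x: "x \<in> verts G" "degree G x = max_degree G" by auto
  obtain s where s: "spectrum G \<alpha> x = {s..<s + max_degree G}"
    using spec[OF x(1)] x(2) by auto
  have full: "spectrum G \<alpha> x = {1..max_degree G}"
    using bound[OF x(1)] by (intro card_subset_eq) (simp_all add: s)
  have "\<alpha> e \<in> {1..max_degree G}" if e: "e \<in> edges G" for e
  proof -
    have "card e = 2" using G e by (auto simp: simple_graph_def)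
    then have "e \<noteq> {}" by auto
    then obtain y where y: "y \<in> e" by blast
    show ?thesis
      using bound[OF in_verts[OF e y]] e y by (auto simp: spectrum_def incident_edges_def)
  qed
  moreover have "{1..max_degree G} \<subseteq> \<alpha> ` edges G"
    unfolding full[symmetric] by (auto simp: spectrum_def incident_edges_def)
  ultimately show "\<alpha> ` edges G = {1..max_degree G}" by blast
next
  fix x assume "x \<in> verts G"
  then obtain s where s: "spectrum G \<alpha> x = {s..<s + degree G x}" using spec by blast
  show "\<exists>a b. spectrum G \<alpha> x = {a..b}"
  proof (cases "degree G x")
    case 0
    then have "spectrum G \<alpha> x = {1..0}" using s by simp
    then show ?thesis by (intro exI)
  next
    case (Suc d)
    then have "spectrum G \<alpha> x = {s..s + d}"
      using s by (simp only: add_Suc_right atLeastLessThanSuc_atLeastAtMost)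
    then show ?thesis by (intro exI)
  qed
qed

section \<open>The edges at the vertices of a triangular fan\<close>

context
  fixes m :: nat
  assumes m: "m \<ge> 2"
begin

lemma verts_fan:
  "verts (triangular_fan (Suc m)) = {U} \<union> V ` {1..m} \<union> W ` {1..m - 1}"
  by (simp add: triangular_fan_def)

lemma incident_U: "incident_edges (triangular_fan (Suc m)) U = (\<lambda>i. {U, V i}) ` {1..m}"
  by (auto simp: incident_edges_def triangular_fan_def)

lemma incident_W:
  assumes "i \<in> {1..m - 1}"
  shows "incident_edges (triangular_fan (Suc m)) (W i) = {{V i, W i}, {W i, V (i + 1)}}"
  using assms by (auto simp: incident_edges_def triangular_fan_def)

lemma incident_V:
  assumes "j \<in> {1..m}"
  shows "incident_edges (triangular_fan (Suc m)) (V j) =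
    {{U, V j}} \<union> (if j < m then {{V j, V (j + 1)}, {V j, W j}} else {})
      \<union> (if 1 < j then {{V (j - 1), V j}, {W (j - 1), V j}} else {})" (is "_ = ?R")
proof
  show "incident_edges (triangular_fan (Suc m)) (V j) \<subseteq> ?R"
  proof
    fix e assume "e \<in> incident_edges (triangular_fan (Suc m)) (V j)"
    then have "V j \<in> e" and "e \<in> edges (triangular_fan (Suc m))"
      by (simp_all add: incident_edges_def)
    then consider i where "e = {U, V i}"
      | i where "1 \<le> i" "i < m" "e \<in> {{V i, W i}, {W i, V (i + 1)}, {V i, V (i + 1)}}"
      by (auto simp: triangular_fan_def)
    then show "e \<in> ?R" using \<open>V j \<in> e\<close> by cases auto
  qed
next
  have spoke: "{U, V j} \<in> edges (triangular_fan (Suc m))"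
    using assms by (auto simp: triangular_fan_def)
  have triangle: "{V i, W i} \<in> edges (triangular_fan (Suc m))"
    "{W i, V (i + 1)} \<in> edges (triangular_fan (Suc m))"
    "{V i, V (i + 1)} \<in> edges (triangular_fan (Suc m))" if "1 \<le> i" "i < m" for i
    using that by (fastforce simp: triangular_fan_def)+
  show "?R \<subseteq> incident_edges (triangular_fan (Suc m)) (V j)"
    using spoke triangle[of j] triangle[of "j - 1"] assms by (auto simp: incident_edges_def)
qed

lemma incident_V_first:
  "incident_edges (triangular_fan (Suc m)) (V 1) = {{U, V 1}, {V 1, V 2}, {V 1, W 1}}"
  using m incident_V[of 1] by (auto simp: numeral_2_eq_2)

lemma incident_V_inner:
  assumes "1 \<le> j" "j + 1 < m"
  shows "incident_edges (triangular_fan (Suc m)) (V (j + 1)) =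
    {{U, V (j + 1)}, {V j, V (j + 1)}, {W j, V (j + 1)},
     {V (j + 1), V (j + 2)}, {V (j + 1), W (j + 1)}}"
  using assms incident_V[of "j + 1"] by auto

lemma incident_V_last:
  "incident_edges (triangular_fan (Suc m)) (V m) =
    {{U, V m}, {V (m - 1), V m}, {W (m - 1), V m}}"
  using m incident_V[of m] by auto

lemma degree_U: "degree (triangular_fan (Suc m)) U = m"
proof -
  have "inj_on (\<lambda>i. {U, V i}) {1..m}" by (auto simp: inj_on_def doubleton_eq_iff)
  then show ?thesis by (simp add: degree_def incident_U card_image)
qed

lemma degree_W: "i \<in> {1..m - 1} \<Longrightarrow> degree (triangular_fan (Suc m)) (W i) = 2"
  by (simp only: degree_def incident_W) (simp add: doubleton_eq_iff)

lemma degree_V_first: "degree (triangular_fan (Suc m)) (V 1) = 3"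
  by (simp only: degree_def incident_V_first) (simp add: doubleton_eq_iff)

lemma degree_V_inner:
  "1 \<le> j \<Longrightarrow> j + 1 < m \<Longrightarrow> degree (triangular_fan (Suc m)) (V (j + 1)) = 5"
  by (simp only: degree_def incident_V_inner) (simp add: doubleton_eq_iff)

lemma degree_V_last: "degree (triangular_fan (Suc m)) (V m) = 3"
  by (simp only: degree_def incident_V_last) (use m in \<open>simp add: doubleton_eq_iff\<close>)

end

section \<open>Colorings given by four sequences\<close>

text \<open>An edge is an unordered pair, so its index has to be read off from its elements; for \<open>v\<^sub>i v\<^sub>i\<^sub>+\<^sub>1\<close>
  it is the smaller of the two.\<close>

definition fan_coloring ::
  "(nat \<Rightarrow> nat) \<Rightarrow> (nat \<Rightarrow> nat) \<Rightarrow> (nat \<Rightarrow> nat) \<Rightarrow> (nat \<Rightarrow> nat) \<Rightarrow> tf_vertex set \<Rightarrow> nat" where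
  "fan_coloring c p a b e =
     (if U \<in> e then c (THE i. V i \<in> e)
      else if \<exists>i. W i \<in> e then
        (let i = (THE i. W i \<in> e) in if V i \<in> e then a i else b i)
      else p (LEAST i. V i \<in> e))"

lemma fan_coloring_edge:
  "fan_coloring c p a b {U, V i} = c i"
  "fan_coloring c p a b {V i, W i} = a i"
  "fan_coloring c p a b {W i, V (i + 1)} = b i"
  "fan_coloring c p a b {V i, V (i + 1)} = p i"
proof -
  have "(LEAST j. j = i \<or> j = Suc i) = i" by (rule Least_equality) auto
  then show "fan_coloring c p a b {V i, V (i + 1)} = p i" by (simp add: fan_coloring_def)
qed (simp_all add: fan_coloring_def)

text \<open>This turns the graph problem into arithmetic of the four sequences. The window starting at \<open>s i\<close>
  is the spectrum of \<open>v\<^sub>i\<close>. The colors at \<open>w\<^sub>i\<close> need no bounds of their own, as they also occur at \<open>v\<^sub>i\<close>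
  and \<open>v\<^sub>i\<^sub>+\<^sub>1\<close>.\<close>

lemma interval_coloring_fan_coloring:
  fixes m :: nat and c p a b s :: "nat \<Rightarrow> nat"
  defines "G \<equiv> triangular_fan (Suc m)"
  assumes m: "m \<ge> 2"
    and hub: "c ` {1..m} = {1..m}"
    and tip: "\<And>i. \<lbrakk>1 \<le> i; i < m\<rbrakk> \<Longrightarrow> b i = a i + 1 \<or> a i = b i + 1"
    and first: "{c 1, p 1, a 1} = {s 1..<s 1 + 3}"
    and inner: "\<And>j. \<lbrakk>1 \<le> j; j + 1 < m\<rbrakk> \<Longrightarrow>
      {c (j + 1), p j, b j, p (j + 1), a (j + 1)} = {s (j + 1)..<s (j + 1) + 5}"
    and last: "{c m, p (m - 1), b (m - 1)} = {s m..<s m + 3}"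
    and lower: "\<And>i. \<lbrakk>1 \<le> i; i \<le> m\<rbrakk> \<Longrightarrow> 1 \<le> s i"
    and upper_end: "s 1 + 2 \<le> max_degree G" "s m + 2 \<le> max_degree G"
    and upper_inner: "\<And>i. \<lbrakk>1 < i; i < m\<rbrakk> \<Longrightarrow> s i + 4 \<le> max_degree G"
  shows "interval_coloring G (max_degree G) (fan_coloring c p a b)"
proof -
  let ?\<alpha> = "fan_coloring c p a b"
  have G: "simple_graph G" unfolding G_def by (rule simple_graph_triangular_fan)
  have v: "verts G = {U} \<union> V ` {1..m} \<union> W ` {1..m - 1}"
    unfolding G_def by (rule verts_fan[OF m])
  note edge = fan_coloring_edge[of c p a b]
  have spec_U: "spectrum G ?\<alpha> U = {1..m}"
    using hub by (simp add: spectrum_def G_def incident_U[OF m] image_image edge)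
  have spec_W: "spectrum G ?\<alpha> (W i) = {a i, b i}" if "1 \<le> i" "i < m" for i
    using that by (simp add: spectrum_def G_def incident_W[OF m, simplified] edge[simplified])
  have first_edges: "spectrum G ?\<alpha> (V 1) = {c 1, p 1, a 1}"
    using edge(4)[of 1] by (simp only: spectrum_def G_def incident_V_first[OF m])
      (simp add: edge numeral_2_eq_2)
  have inner_edges: "spectrum G ?\<alpha> (V (j + 1)) = {c (j + 1), p j, b j, p (j + 1), a (j + 1)}"
    if "1 \<le> j" "j + 1 < m" for j
    using edge(4)[of "j + 1"] by (simp only: spectrum_def G_def incident_V_inner[OF m that])
      (simp add: edge[simplified])
  have last_edges: "spectrum G ?\<alpha> (V m) = {c m, p (m - 1), b (m - 1)}"
    using edge(3,4)[of "m - 1"] m by (simp only: spectrum_def G_def incident_V_last[OF m])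
      (simp add: edge)
  note deg_first = degree_V_first[OF m, folded G_def]
    and deg_inner = degree_V_inner[OF m, folded G_def]
    and deg_last = degree_V_last[OF m, folded G_def]
  have V_cases: "i = 1 \<or> i = m \<or> (\<exists>j. 1 \<le> j \<and> j + 1 < m \<and> i = j + 1)"
    if "i \<in> {1..m}" for i
    using that by (cases i) auto
  have spec_V: "spectrum G ?\<alpha> (V i) = {s i..<s i + degree G (V i)}" if "i \<in> {1..m}" for i
    using V_cases[OF that]
  proof (elim disjE exE conjE)
    assume "i = 1"
    then show ?thesis by (simp only: first_edges first deg_first)
  next
    assume "i = m"
    then show ?thesis by (simp only: last_edges last deg_last)
  next
    fix j assume "1 \<le> j" "j + 1 < m" "i = j + 1"
    then show ?thesis by (simp only: inner_edges inner deg_inner)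
  qed
  have bound_V: "spectrum G ?\<alpha> (V i) \<subseteq> {1..max_degree G}" if i: "i \<in> {1..m}" for i
  proof -
    have "s i + degree G (V i) \<le> max_degree G + 1"
      using V_cases[OF i]
    proof (elim disjE exE conjE)
      fix j assume "1 \<le> j" "j + 1 < m" "i = j + 1"
      then show ?thesis using deg_inner[of j] upper_inner[of i] by simp
    qed (use upper_end deg_first deg_last in simp_all)
    then show ?thesis using spec_V[OF i] lower[of i] i by auto
  qed
  show ?thesis
  proof (rule interval_coloring_max_degreeI[OF G])
    show "verts G \<noteq> {}" by (simp add: v)
  next
    fix x assume x: "x \<in> verts G"
    then consider "x = U" | i where "x = V i" "i \<in> {1..m}"
      | i where "x = W i" "1 \<le> i" "i < m" "i \<in> {1..m - 1}"
      using m unfolding v by auto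
    note cases = this
    show "\<exists>s. spectrum G ?\<alpha> x = {s..<s + degree G x}"
      using cases
    proof cases
      case 1
      have "{1..m} = {1..<1 + m}" by auto
      then have "spectrum G ?\<alpha> x = {1..<1 + degree G x}"
        by (simp only: 1 spec_U degree_U[OF m, folded G_def])
      then show ?thesis by (rule exI)
    next
      case (2 i)
      then show ?thesis using spec_V[of i] by (intro exI) simp
    next
      case (3 i)
      have "degree G x = 2" using 3 degree_W[OF m] by (simp add: G_def)
      moreover have "{a i, b i} = {min (a i) (b i)..<min (a i) (b i) + 2}"
        using tip[OF 3(2,3)] by auto
      ultimately have "spectrum G ?\<alpha> x = {min (a i) (b i)..<min (a i) (b i) + degree G x}"
        using 3(1) spec_W[OF 3(2,3)] by simp
      then show ?thesis by (rule exI)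
    qed
    show "spectrum G ?\<alpha> x \<subseteq> {1..max_degree G}"
      using cases
    proof cases
      case 1
      have "m \<le> max_degree G"
        using degree_le_max_degree[OF G x] 1 degree_U[OF m] by (simp add: G_def)
      then show ?thesis using 1 spec_U by auto
    next
      case (2 i)
      then show ?thesis using bound_V[of i] by simp
    next
      case (3 i)
      have "a i \<in> spectrum G ?\<alpha> (V i)"
      proof (cases "i = 1")
        case True
        then show ?thesis by (simp only: first_edges) simp
      next
        case False
        with 3 obtain j where "i = j + 1" "1 \<le> j" "j + 1 < m" by (cases i) auto
        then show ?thesis by (simp only: inner_edges) simp
      qed
      moreover have "b i \<in> spectrum G ?\<alpha> (V (i + 1))"
      proof (cases "i + 1 = m")
        case True
        then have "m - 1 = i" by simp
        then show ?thesis using last_edges by (simp only: True) simp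
      next
        case False
        with 3 have "1 \<le> i" "i + 1 < m" by simp_all
        then show ?thesis by (simp only: inner_edges) simp
      qed
      moreover have "i \<in> {1..m}" "i + 1 \<in> {1..m}" using 3 by simp_all
      ultimately have "a i \<in> {1..max_degree G}" "b i \<in> {1..max_degree G}"
        using bound_V by (meson subsetD)+
      then show ?thesis using 3(1) spec_W[OF 3(2,3)] by simp
    qed
  qed
qed

section \<open>Colorings of the triangular fans\<close>

definition spoke_color :: "nat \<Rightarrow> nat \<Rightarrow> nat" where
  "spoke_color m i =
    (if i = 1 then 2 else if i = 2 then 1 else if i = m - 1 then m else if i = m then m - 1 else i)"

definition path_color :: "nat \<Rightarrow> nat" where
  "path_color i = (if i = 1 then 4 else if i = 2 then 5 else i - 2)"

definition left_color :: "nat \<Rightarrow> nat \<Rightarrow> nat" where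
  "left_color m i = (if i \<le> 2 then 3 else if i = m - 1 then m - 1 else i + 1)"

definition right_color :: "nat \<Rightarrow> nat \<Rightarrow> nat" where
  "right_color m i = (if i \<le> 2 then 2 else if i = m - 1 then m - 2 else i)"

text \<open>The window of the regular pattern at \<open>v\<^sub>i\<close> starts at \<open>i - 3\<close>; the repair at the beginning
  pushes it up to start at \<open>1\<close> for \<open>i = 2, 3\<close> and at \<open>2\<close> for \<open>v\<^sub>1\<close>.\<close>

definition window_start :: "nat \<Rightarrow> nat" where
  "window_start i = (if i = 1 then 2 else max 1 (i - 3))"

lemmas shifting_coloring_defs =
  spoke_color_def path_color_def left_color_def right_color_def window_start_def

lemma spoke_color_image:
  assumes "m \<ge> 4"
  shows "spoke_color m ` {1..m} = {1..m}"
proof (rule endo_inj_surj)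
  show "spoke_color m ` {1..m} \<subseteq> {1..m}" using assms by (auto simp: spoke_color_def)
  show "inj_on (spoke_color m) {1..m}"
    \<comment> \<open>two disjoint transpositions\<close>
    using assms by (intro inj_on_inverseI[where g = "spoke_color m"]) (auto simp: spoke_color_def)
qed simp

text \<open>From \<open>v\<^sub>4\<close> on, the repair at the beginning is no longer visible, and the repair at the end only
  interchanges colors inside the window of \<open>v\<^sub>m\<^sub>-\<^sub>1\<close>.\<close>

lemma shifting_coloring_inner_spectrum:
  assumes m: "m \<ge> 4" and j: "1 \<le> j" "j + 1 < m"
  shows "{spoke_color m (j + 1), path_color j, right_color m j, path_color (j + 1), left_color m (j + 1)}
    = {window_start (j + 1)..<window_start (j + 1) + 5}"
proof -
  consider "j = 1" | "j = 2" | "j \<ge> 3" using j by linarith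
  then show ?thesis
  proof cases
    case 1
    then show ?thesis using m by (auto simp: shifting_coloring_defs)
  next
    case 2
    then show ?thesis using m j by (auto simp: shifting_coloring_defs)
  next
    case 3
    then obtain k where k: "j = k + 3" by (metis add.commute le_Suc_ex)
    have "path_color j = k + 1" "path_color (j + 1) = k + 2" "right_color m j = k + 3"
      using j by (auto simp: path_color_def right_color_def k)
    moreover have "spoke_color m (j + 1) = k + 4 \<and> left_color m (j + 1) = k + 5 \<or>
        spoke_color m (j + 1) = k + 5 \<and> left_color m (j + 1) = k + 4"
      using j by (auto simp: spoke_color_def left_color_def k)
    moreover have "window_start (j + 1) = k + 1" by (simp add: window_start_def k)
    ultimately show ?thesis by auto
  qed
qed

lemma interval_coloring_shifting:
  assumes m: "m \<ge> 4"
    and deg: "m \<le> max_degree (triangular_fan (Suc m))" "5 \<le> max_degree (triangular_fan (Suc m))"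
  shows "interval_coloring (triangular_fan (Suc m)) (max_degree (triangular_fan (Suc m)))
    (fan_coloring (spoke_color m) path_color (left_color m) (right_color m))"
proof (rule interval_coloring_fan_coloring[where s = window_start])
  show "m \<ge> 2" using m by simp
  show "spoke_color m ` {1..m} = {1..m}" by (rule spoke_color_image[OF m])
  show "right_color m i = left_color m i + 1 \<or> left_color m i = right_color m i + 1"
    if "1 \<le> i" "i < m" for i
    using that m by (auto simp: left_color_def right_color_def)
  show "{spoke_color m 1, path_color 1, left_color m 1} = {window_start 1..<window_start 1 + 3}"
    by (auto simp: shifting_coloring_defs)
  show "{spoke_color m m, path_color (m - 1), right_color m (m - 1)} =
      {window_start m..<window_start m + 3}"
  proof -
    obtain k where k: "m = k + 4" using m by (metis add.commute le_Suc_ex)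
    show ?thesis by (auto simp: spoke_color_def path_color_def right_color_def window_start_def k)
  qed
  show "1 \<le> window_start i" for i by (simp add: window_start_def)
  show "window_start 1 + 2 \<le> max_degree (triangular_fan (Suc m))"
    using deg by (simp add: window_start_def)
  show "window_start m + 2 \<le> max_degree (triangular_fan (Suc m))"
    using deg m by (auto simp: window_start_def)
  show "window_start i + 4 \<le> max_degree (triangular_fan (Suc m))" if "1 < i" "i < m" for i
    using deg that by (auto simp: window_start_def)
qed (rule shifting_coloring_inner_spectrum[OF m])

theorem theorem5:
  fixes n :: nat
  assumes "n \<ge> 3"
  shows "\<exists>\<alpha>. interval_coloring (triangular_fan n) (max_degree (triangular_fan n)) \<alpha>"
proof -
  define m where "m = n - 1"
  have n: "n = Suc m" and m: "m \<ge> 2" using assms by (auto simp: m_def)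
  let ?D = "max_degree (triangular_fan (Suc m))"
  note deg_le = degree_le_max_degree[OF simple_graph_triangular_fan, of _ "Suc m"]
  have D3: "3 \<le> ?D"
    using deg_le[of "V 1"] degree_V_first[OF m] m by (auto simp: verts_fan[OF m])
  have Dm: "m \<le> ?D"
    using deg_le[of U] degree_U[OF m] by (simp add: verts_fan[OF m])
  have D5: "5 \<le> ?D" if "m \<ge> 3"
    using deg_le[of "V 2"] degree_V_inner[OF m, of 1] that by (auto simp: verts_fan[OF m] numeral_2_eq_2)
  consider "m = 2" | "m = 3" | "m \<ge> 4" using m by linarith
  then show ?thesis
  proof cases
    case 1
    have "interval_coloring (triangular_fan (Suc m)) ?D
        (fan_coloring (\<lambda>i. i) (\<lambda>_. 3) (\<lambda>_. 2) (\<lambda>_. 1))"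
      by (rule interval_coloring_fan_coloring[where s = "\<lambda>_. 1"]) (use 1 D3 in auto)
    then show ?thesis unfolding n by blast
  next
    case 2
    \<comment> \<open>The first two triangles are colored as for large \<open>m\<close>, with one exception: as \<open>v\<^sub>3\<close> is the last
      vertex of the path and \<open>u v\<^sub>3\<close>, \<open>v\<^sub>2 v\<^sub>3\<close> have the colors \<open>3, 5\<close>, the edge \<open>w\<^sub>2 v\<^sub>3\<close> must get \<open>4\<close>.\<close>
    have "interval_coloring (triangular_fan (Suc m)) ?D
        (fan_coloring ((\<lambda>i. i)(1 := 2, 2 := 1)) (\<lambda>i. i + 3) (\<lambda>_. 3) (\<lambda>i. 2 * i))"
    proof (rule interval_coloring_fan_coloring[where s = "(\<lambda>i. i)(1 := 2, 2 := 1)"])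
      have "{1..m} = {1, 2, 3}" using 2 by auto
      then show "((\<lambda>i. i)(1 := 2, 2 := 1)) ` {1..m} = {1..m}" by auto
      show "2 * i = 3 + 1 \<or> 3 = 2 * i + 1" if "1 \<le> i" "i < m" for i :: nat
        using that 2 by auto
    qed (use 2 D5 in \<open>auto simp: le_Suc_eq\<close>)
    then show ?thesis unfolding n by blast
  next
    case 3
    then have "m \<ge> 3" by simp
    then show ?thesis
      unfolding n by (intro exI) (rule interval_coloring_shifting[OF 3 Dm D5])
  qed
qed

end
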